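(* Suppose that there exist $\theta \in (0,1]$, $\phi \in \mathbb{R}$, $x_0 < \infty$ and $C < \infty$ such that, for all $x \geq x_0$ and all $t \in \mathbb{Z}^+$, $$\mathbb{P} [ \Delta^+_t \geq x \mid \mathcal{F}_t ] \leq C x^{-\theta} (\log x)^\phi \quad \text{a.s.}$$ (i) If $\theta \in (0,1)$, then, for any $\varepsilon>0$, a.s., for all but finitely many $t \in \mathbb{Z}^+$, $$X_t \leq t^{1/\theta} (\log t)^{\frac{\phi+2}{\theta} +\varepsilon}.$$ (ii) If $\theta = 1$, then, for any $\varepsilon>0$, a.s., for all but finitely many $t\in\mathbb{Z}^+$, $$X_t \leq t (\log t)^{ (1+\phi)^+ + 1 +\varepsilon}.$$
   Context: $\mathbb{Z}^+ = \{0,1,2,\ldots\}$. $(X_t)_{t \in \mathbb{Z}^+}$ is a real-valued stochastic process adapted to a filtration $(\mathcal{F}_t)_{t \in \mathbb{Z}^+}$, with $X_0 = 0$ (no Markov property is assumed). Its increments are $\Delta_t := X_{t+1} - X_t$. For real $x$, $x^+ := x \mathbf{1}\{x>0\}$; $\Delta_t^+ := (\Delta_t)^+$. The constants $C, x_0$ are non-random and do not depend on $t$; $x_0$ is understood to exceed $1$ so that $(\log x)^\phi$ is defined for $x \geq x_0$. *)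

theory Defs
  imports "HOL-Probability.Probability"
begin

definition increment :: "(nat \<Rightarrow> 'a \<Rightarrow> real) \<Rightarrow> nat \<Rightarrow> 'a \<Rightarrow> real"
  where "increment X t \<omega> = X (Suc t) \<omega> - X t \<omega>"

definition pos_part :: "real \<Rightarrow> real"
  where "pos_part x = (if x > 0 then x else 0)"

text \<open>
  Conditional probability of the event \<open>P\<close> given a sub-sigma-algebra \<open>F\<close>. This is one
  version, determined only up to almost sure equality. It is meaningful only for measurable
  \<open>P\<close> and \<open>subalgebra M F\<close>; otherwise the library's conditional expectation returns a
  dummy value.
\<close>

definition cond_prob_alg :: "'a measure \<Rightarrow> 'a measure \<Rightarrow> ('a \<Rightarrow> bool) \<Rightarrow> 'a \<Rightarrow> real"
  where "cond_prob_alg M F P = real_cond_exp M F (indicator {\<omega> \<in> space M. P \<omega>})"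

end

theory Submission
  imports Defs "HOL-Real_Asymp.Real_Asymp"
begin

text \<open>
  The process is dominated by the sums of the positive parts \<open>Y\<^sub>t = \<Delta>\<^sub>t\<^sup>+\<close>, and integrating the
  hypothesis turns it into a bound on the unconditional tails of \<open>Y\<^sub>t\<close>, uniform in \<open>t\<close>. The
  rest is a first moment argument for truncated variables.

  Let \<open>b\<^sub>t = t\<^bsup>1/\<theta>\<^esup> (log t)\<^bsup>r\<^esup>\<close>. If \<open>\<Sum>\<^sub>t E[min (Y\<^sub>t / b\<^sub>t) 1] < \<infinity>\<close>, then almost surely
  \<open>\<Sum>\<^sub>t min (Y\<^sub>t / b\<^sub>t) 1 < \<infinity>\<close>. This says at once that only finitely many \<open>Y\<^sub>t\<close> exceed \<open>b\<^sub>t\<close>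
  (a Borel--Cantelli statement) and that \<open>\<Sum>\<^sub>t Y\<^sub>t / b\<^sub>t\<close> converges, whence Kronecker's lemma gives
  \<open>Y\<^sub>0 + \<dots> + Y\<^sub>t\<^sub>-\<^sub>1 \<le> b\<^sub>t\<close> for all large \<open>t\<close>. This is \<open>AE_eventually_sum_le\<close>.

  It remains to bound \<open>E[min Y b]\<close>, which is the integral of the tail of \<open>Y\<close> over \<open>[0, b]\<close>. Fix
  \<open>q \<ge> \<phi> + 1\<close>, with \<open>q > 0\<close> in case \<open>\<theta> = 1\<close>. The function \<open>G(x) = x\<^bsup>1-\<theta>\<^esup> (log x)\<^bsup>q\<^esup>\<close> has derivative
  \<open>x\<^bsup>-\<theta>\<^esup> (log x)\<^bsup>q-1\<^esup> ((1 - \<theta>) log x + q)\<close>, which for large \<open>x\<close> is at least a constant multiple of the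
  assumed tail bound; so \<open>E[min Y b] \<le> K G(b)\<close> (\<open>nn_integral_min_le_power_log\<close>). As \<open>log b\<^sub>t\<close> is of
  order \<open>log t\<close>, the ratio \<open>G(b\<^sub>t) / b\<^sub>t\<close> is of order \<open>t\<^bsup>-1\<^esup> (log t)\<^bsup>q-\<theta>r\<^esup>\<close>, and this is summable as
  soon as \<open>\<theta> r > q + 1\<close>. For \<open>\<theta> < 1\<close> take \<open>q = \<phi> + 1\<close>; for \<open>\<theta> = 1\<close> take
  \<open>q = max (\<phi> + 1) (\<epsilon>/2)\<close>, where the requirement \<open>q > 0\<close> is what produces the positive part
  \<open>(1 + \<phi>)\<^sup>+\<close> in the exponent.
\<close>

section \<open>Truncated expectations\<close>

text \<open>
  Layer cake formula: \<open>E[min Y b]\<close> is the integral over \<open>[0, b]\<close> of the tail of \<open>Y\<close>. The tail is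
  at most 1 on \<open>[0, a]\<close>, which contributes the summand \<open>a\<close>, and at most \<open>G'\<close> on \<open>[a, b]\<close>. Working
  with an antiderivative avoids evaluating or estimating the integral of the tail bound.
\<close>

lemma (in prob_space) nn_integral_min_le_tail_antiderivative:
  fixes Y :: "'a \<Rightarrow> real"
  assumes Y [measurable]: "Y \<in> borel_measurable M"
    and nonneg: "\<And>\<omega>. \<omega> \<in> space M \<Longrightarrow> 0 \<le> Y \<omega>"
    and ab: "0 \<le> a" "a \<le> b"
    and g [measurable]: "g \<in> borel_measurable borel"
    and tail: "\<And>x. a \<le> x \<Longrightarrow> x \<le> b \<Longrightarrow> prob {\<omega> \<in> space M. x \<le> Y \<omega>} \<le> g x"
    and deriv: "\<And>x. a \<le> x \<Longrightarrow> x \<le> b \<Longrightarrow> (G has_real_derivative g x) (at x)"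
  shows "(\<integral>\<^sup>+\<omega>. ennreal (min (Y \<omega>) b) \<partial>M) \<le> ennreal (a + (G b - G a))"
proof -
  interpret pair_sigma_finite lborel M ..
  have g_nonneg: "0 \<le> g x" if "a \<le> x" "x \<le> b" for x
    using tail[OF that] measure_nonneg[of M "{\<omega> \<in> space M. x \<le> Y \<omega>}"] by linarith
  have FTC: "(\<integral>\<^sup>+x. ennreal (g x) * indicator {a..b} x \<partial>lborel) = ennreal (G b - G a)"
    using ab g_nonneg deriv by (intro nn_integral_FTC_Icc) auto
  have G_mono: "G a \<le> G b"
    by (rule DERIV_nonneg_imp_nondecreasing[OF ab(2)]) (metis deriv g_nonneg)
  have "(\<integral>\<^sup>+\<omega>. ennreal (min (Y \<omega>) b) \<partial>M)
      = (\<integral>\<^sup>+\<omega>. (\<integral>\<^sup>+x. indicator {0..b} x * indicator {x. x \<le> Y \<omega>} x \<partial>lborel) \<partial>M)"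
  proof (intro nn_integral_cong)
    fix \<omega> assume \<omega>: "\<omega> \<in> space M"
    have "(\<integral>\<^sup>+x. indicator {0..b} x * indicator {x. x \<le> Y \<omega>} x \<partial>lborel)
        = (\<integral>\<^sup>+x. indicator {0..min (Y \<omega>) b} x \<partial>lborel)"
      by (intro nn_integral_cong) (auto simp: indicator_def)
    also have "\<dots> = ennreal (min (Y \<omega>) b)"
      using nonneg[OF \<omega>] ab by simp
    finally show "ennreal (min (Y \<omega>) b)
        = (\<integral>\<^sup>+x. indicator {0..b} x * indicator {x. x \<le> Y \<omega>} x \<partial>lborel)" ..
  qed
  also have "\<dots> = (\<integral>\<^sup>+x. (\<integral>\<^sup>+\<omega>. indicator {0..b} x * indicator {x. x \<le> Y \<omega>} x \<partial>M) \<partial>lborel)"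
    by (rule Fubini') measurable
  also have "\<dots> = (\<integral>\<^sup>+x. indicator {0..b} x * ennreal (prob {\<omega> \<in> space M. x \<le> Y \<omega>}) \<partial>lborel)"
  proof (intro nn_integral_cong)
    fix x :: real
    have "(\<integral>\<^sup>+\<omega>. indicator {0..b} x * indicator {x. x \<le> Y \<omega>} x \<partial>M)
        = indicator {0..b} x * (\<integral>\<^sup>+\<omega>. indicator {\<omega> \<in> space M. x \<le> Y \<omega>} \<omega> \<partial>M)"
      by (subst nn_integral_cmult[symmetric]) (auto intro!: nn_integral_cong simp: indicator_def)
    also have "(\<integral>\<^sup>+\<omega>. indicator {\<omega> \<in> space M. x \<le> Y \<omega>} \<omega> \<partial>M)
        = ennreal (prob {\<omega> \<in> space M. x \<le> Y \<omega>})"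
      by (simp add: emeasure_eq_measure)
    finally show "(\<integral>\<^sup>+\<omega>. indicator {0..b} x * indicator {x. x \<le> Y \<omega>} x \<partial>M)
        = indicator {0..b} x * ennreal (prob {\<omega> \<in> space M. x \<le> Y \<omega>})" .
  qed
  also have "\<dots> \<le> (\<integral>\<^sup>+x. indicator {0..a} x + ennreal (g x) * indicator {a..b} x \<partial>lborel)"
  proof (intro nn_integral_mono)
    fix x :: real
    have "ennreal (prob {\<omega> \<in> space M. x \<le> Y \<omega>}) \<le> 1"
      by simp
    moreover have "ennreal (prob {\<omega> \<in> space M. x \<le> Y \<omega>}) \<le> ennreal (g x)" if "a \<le> x" "x \<le> b"
      using tail[OF that] by (rule ennreal_leI)
    ultimately show "indicator {0..b} x * ennreal (prob {\<omega> \<in> space M. x \<le> Y \<omega>})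
        \<le> indicator {0..a} x + ennreal (g x) * indicator {a..b} x"
      by (auto simp: indicator_def add_increasing)
  qed
  also have "\<dots> = ennreal a + ennreal (G b - G a)"
    using ab by (simp add: nn_integral_add FTC)
  also have "\<dots> = ennreal (a + (G b - G a))"
    using ab G_mono by (simp add: ennreal_plus)
  finally show ?thesis .
qed

section \<open>Normalised sums of nonnegative variables\<close>

lemma eventually_nondecreasingE:
  fixes b :: "nat \<Rightarrow> 'b :: order"
  assumes "eventually (\<lambda>n. b n \<le> b (Suc n)) sequentially"
  obtains N where "\<And>m n. N \<le> m \<Longrightarrow> m \<le> n \<Longrightarrow> b m \<le> b n"
proof -
  obtain N where N: "\<And>n. N \<le> n \<Longrightarrow> b n \<le> b (Suc n)"
    using assms by (auto simp: eventually_sequentially)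
  have "b m \<le> b n" if "N \<le> m" "m \<le> n" for m n
    using that(2) by (induction rule: dec_induct) (use N that(1) in \<open>auto intro: order_trans\<close>)
  then show thesis
    by (rule that)
qed

text \<open>
  A truncated series that converges is eventually not truncated, so \<open>\<Sum> y n / b n\<close> converges as
  well. The conclusion is then the nonnegative case of Kronecker's lemma: beyond a suitable index
  \<open>N\<close> the tail of the series is at most 1/2, and since \<open>b\<close> is nondecreasing there, the terms of
  index \<open>N \<le> k < n\<close> contribute at most \<open>b n / 2\<close> to the sum, while the sum of the first
  \<open>N\<close> terms is a constant and hence eventually at most \<open>b n / 2\<close>.
\<close>

lemma eventually_sum_le_of_summable_min:
  fixes y b :: "nat \<Rightarrow> real"
  assumes nonneg: "\<And>n. 0 \<le> y n"
    and mono: "eventually (\<lambda>n. b n \<le> b (Suc n)) sequentially"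
    and lim: "filterlim b at_top sequentially"
    and summable: "summable (\<lambda>n. min (y n / b n) 1)"
  shows "eventually (\<lambda>n. (\<Sum>k<n. y k) \<le> b n) sequentially"
proof -
  have "(\<lambda>n. min (y n / b n) 1) \<longlonglongrightarrow> 0"
    using summable by (rule summable_LIMSEQ_zero)
  then have "eventually (\<lambda>n. min (y n / b n) 1 < 1) sequentially"
    by (rule order_tendstoD) simp
  then have "eventually (\<lambda>n. min (y n / b n) 1 = y n / b n) sequentially"
    by eventually_elim auto
  then have sb: "summable (\<lambda>n. y n / b n)"
    using summable by (simp add: summable_cong)
  then obtain N1 where N1: "\<And>n m. N1 \<le> m \<Longrightarrow> norm (\<Sum>k=m..<n. y k / b k) < 1/2"
    unfolding summable_Cauchy by (metis half_gt_zero_iff zero_less_one)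
  have "eventually (\<lambda>n. b n > 0) sequentially"
    using lim by (simp add: filterlim_at_top_dense)
  then obtain N2 where N2: "\<And>n. N2 \<le> n \<Longrightarrow> b n > 0"
    by (auto simp: eventually_sequentially)
  obtain N3 where N3: "\<And>m n. N3 \<le> m \<Longrightarrow> m \<le> n \<Longrightarrow> b m \<le> b n"
    using eventually_nondecreasingE[OF mono] by blast
  define N where "N = max N1 (max N2 N3)"
  have "eventually (\<lambda>n. b n \<ge> 2 * (\<Sum>k<N. y k)) sequentially"
    using lim by (simp add: filterlim_at_top)
  then show ?thesis
    using eventually_ge_at_top[of N]
  proof eventually_elim
    case (elim n)
    have bn: "0 < b n"
      using N2[of n] elim by (simp add: N_def)
    have "(\<Sum>k=N..<n. y k) \<le> (\<Sum>k=N..<n. b n * (y k / b k))"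
    proof (intro sum_mono)
      fix k assume k: "k \<in> {N..<n}"
      have "0 < b k" "b k \<le> b n"
        using N2[of k] N3[of k n] k by (auto simp: N_def)
      then show "y k \<le> b n * (y k / b k)"
        using nonneg[of k] by (simp add: field_simps mult_right_mono)
    qed
    also have "\<dots> = b n * (\<Sum>k=N..<n. y k / b k)"
      by (simp add: sum_distrib_left)
    also have "\<dots> \<le> b n * (1/2)"
      using N1[of N n] bn by (intro mult_left_mono) (auto simp: N_def)
    finally have "(\<Sum>k=N..<n. y k) \<le> b n / 2"
      by simp
    moreover have "(\<Sum>k<n. y k) = (\<Sum>k<N. y k) + (\<Sum>k=N..<n. y k)"
      using elim sum.atLeastLessThan_concat[of 0 N n y] by (simp add: lessThan_atLeast0)
    ultimately show ?case
      using elim by linarith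
  qed
qed

text \<open>
  By monotone convergence the random series of truncated ratios has finite expectation, hence it
  converges almost surely, and Kronecker's lemma applies to almost every sample point.
\<close>

lemma AE_eventually_sum_le:
  fixes Y :: "nat \<Rightarrow> 'a \<Rightarrow> real" and b e :: "nat \<Rightarrow> real"
  assumes Y [measurable]: "\<And>n. Y n \<in> borel_measurable M"
    and nonneg: "\<And>n \<omega>. \<omega> \<in> space M \<Longrightarrow> 0 \<le> Y n \<omega>"
    and mono: "eventually (\<lambda>n. b n \<le> b (Suc n)) sequentially"
    and lim: "filterlim b at_top sequentially"
    and e: "summable e" "\<And>n. 0 \<le> e n"
    and bound: "eventually (\<lambda>n. (\<integral>\<^sup>+\<omega>. ennreal (min (Y n \<omega>) (b n)) \<partial>M) \<le> ennreal (b n * e n))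
                  sequentially"
  shows "AE \<omega> in M. eventually (\<lambda>n. (\<Sum>k<n. Y k \<omega>) \<le> b n) sequentially"
proof -
  have "eventually (\<lambda>n. b n > 0) sequentially"
    using lim by (simp add: filterlim_at_top_dense)
  with bound have "eventually (\<lambda>n. b n > 0 \<and>
      (\<integral>\<^sup>+\<omega>. ennreal (min (Y n \<omega>) (b n)) \<partial>M) \<le> ennreal (b n * e n)) sequentially"
    by eventually_elim simp
  then obtain N where pos: "\<And>n. N \<le> n \<Longrightarrow> b n > 0"
    and N: "\<And>n. N \<le> n \<Longrightarrow> (\<integral>\<^sup>+\<omega>. ennreal (min (Y n \<omega>) (b n)) \<partial>M) \<le> ennreal (b n * e n)"
    by (auto simp: eventually_sequentially)
  have scaled: "(\<integral>\<^sup>+\<omega>. ennreal (min (Y n \<omega> / b n) 1) \<partial>M) \<le> ennreal (e n)" if n: "N \<le> n" for n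
  proof -
    have "min (Y n \<omega> / b n) 1 = (1 / b n) * min (Y n \<omega>) (b n)" for \<omega>
      using pos[OF n] by (simp add: min_def field_simps)
    then have "(\<integral>\<^sup>+\<omega>. ennreal (min (Y n \<omega> / b n) 1) \<partial>M)
        = (\<integral>\<^sup>+\<omega>. ennreal (1 / b n) * ennreal (min (Y n \<omega>) (b n)) \<partial>M)"
      using pos[OF n] nonneg by (intro nn_integral_cong) (simp flip: ennreal_mult'')
    also have "\<dots> = ennreal (1 / b n) * (\<integral>\<^sup>+\<omega>. ennreal (min (Y n \<omega>) (b n)) \<partial>M)"
      by (rule nn_integral_cmult) measurable
    also have "\<dots> \<le> ennreal (1 / b n) * ennreal (b n * e n)"
      using N[OF n] by (intro mult_left_mono) auto
    also have "\<dots> = ennreal (e n)"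
      using pos[OF n] e(2) by (simp flip: ennreal_mult)
    finally show ?thesis .
  qed
  \<comment> \<open>The shift by \<open>N\<close> skips the indices for which \<open>b n\<close> need not be positive.\<close>
  have "(\<integral>\<^sup>+\<omega>. (\<Sum>n. ennreal (min (Y (n + N) \<omega> / b (n + N)) 1)) \<partial>M)
      = (\<Sum>n. \<integral>\<^sup>+\<omega>. ennreal (min (Y (n + N) \<omega> / b (n + N)) 1) \<partial>M)"
    by (rule nn_integral_suminf) measurable
  also have "\<dots> \<le> (\<Sum>n. ennreal (e (n + N)))"
    by (intro suminf_le scaled) auto
  also have "\<dots> < \<infinity>"
    using e by (simp add: ennreal_suminf_neq_top summable_iff_shift less_top[symmetric])
  finally have "AE \<omega> in M. (\<Sum>n. ennreal (min (Y (n + N) \<omega> / b (n + N)) 1)) \<noteq> \<infinity>"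
    by (intro nn_integral_PInf_AE) auto
  then show ?thesis
    using AE_space
  proof eventually_elim
    case (elim \<omega>)
    have "summable (\<lambda>n. min (Y (n + N) \<omega> / b (n + N)) 1)"
      using elim nonneg pos[THEN less_imp_le] by (intro summable_suminf_not_top) auto
    then have "summable (\<lambda>n. min (Y n \<omega> / b n) 1)"
      by (subst (asm) summable_iff_shift)
    with nonneg[OF elim(2)] mono lim show ?case
      by (rule eventually_sum_le_of_summable_min)
  qed
qed

section \<open>Power-logarithmic normalisation\<close>

text \<open>
  Up to the factor \<open>p - 1\<close>, the summand is asymptotic to the decrement of \<open>(ln n) powr (1 - p)\<close>
  from \<open>n\<close> to \<open>n + 1\<close>, and these decrements telescope.
\<close>

lemma summable_inverse_mult_ln_powr:
  fixes p :: real
  assumes "1 < p"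
  shows "summable (\<lambda>n. 1 / (real n * ln (real n) powr p))"
proof (rule summable_comparison_test_bigo)
  have "(\<lambda>n. ln (real n) powr (1 - p)) \<longlonglongrightarrow> 0"
    using assms by real_asymp
  then have "summable (\<lambda>n. ln (real n) powr (1 - p) - ln (real (Suc n)) powr (1 - p))"
    by (rule telescope_summable')
  moreover have "eventually (\<lambda>n. 0 \<le> ln (real n) powr (1 - p) - ln (real (Suc n)) powr (1 - p)) sequentially"
    using assms by real_asymp
  ultimately show "summable (\<lambda>n. norm (ln (real n) powr (1 - p) - ln (real (Suc n)) powr (1 - p)))"
    by (subst summable_cong[where g = "\<lambda>n. ln (real n) powr (1 - p) - ln (real (Suc n)) powr (1 - p)"])
       (auto elim: eventually_mono)
  show "(\<lambda>n. 1 / (real n * ln (real n) powr p))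
      \<in> O(\<lambda>n. ln (real n) powr (1 - p) - ln (real (Suc n)) powr (1 - p))"
    using assms by real_asymp
qed

text \<open>
  The extra power of the logarithm allowed by \<open>\<phi> + 1 \<le> q\<close> is needed when \<open>\<theta> = 1\<close>, where the tail
  bound integrates to \<open>(log b) powr (\<phi> + 1)\<close> if \<open>\<phi> > - 1\<close>; the condition \<open>0 < q\<close> covers the
  other \<open>\<phi>\<close>, for which the integral grows at most like \<open>log (log b)\<close>. For \<open>\<theta> < 1\<close> the bound is
  not sharp, but it is enough, and it permits both cases to be treated with the same function.
\<close>

lemma (in prob_space) nn_integral_min_le_power_log:
  fixes Y :: "'i \<Rightarrow> 'a \<Rightarrow> real" and C \<theta> \<phi> q x\<^sub>0 :: real
  assumes Y: "\<And>i. Y i \<in> borel_measurable M"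
    and nonneg: "\<And>i \<omega>. \<omega> \<in> space M \<Longrightarrow> 0 \<le> Y i \<omega>"
    and \<theta>: "0 < \<theta>" "\<theta> \<le> 1"
    and uniform_tail: "\<And>i x. x\<^sub>0 \<le> x \<Longrightarrow>
        prob {\<omega> \<in> space M. x \<le> Y i \<omega>} \<le> C * x powr (- \<theta>) * ln x powr \<phi>"
    and q: "\<phi> + 1 \<le> q" "\<theta> < 1 \<or> 0 < q"
  shows "\<exists>K a. 0 \<le> K \<and> (\<forall>i. \<forall>b\<ge>a.
      (\<integral>\<^sup>+\<omega>. ennreal (min (Y i \<omega>) b) \<partial>M) \<le> ennreal (K * (b powr (1 - \<theta>) * ln b powr q)))"
proof -
  \<comment> \<open>An eventual lower bound for the last factor of \<open>G'\<close>: it tends to infinity if \<open>\<theta> < 1\<close> and is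
    the constant \<open>q\<close> if \<open>\<theta> = 1\<close>.\<close>
  define c where "c = (if \<theta> < 1 then 1 else q)"
  have c: "0 < c"
    using q(2) by (auto simp: c_def)
  have "eventually (\<lambda>x. c \<le> (1 - \<theta>) * ln x + q) at_top"
  proof (cases "\<theta> < 1")
    case True
    then show ?thesis
      unfolding c_def using \<theta> by simp real_asymp
  next
    case False
    then show ?thesis
      using \<theta> by (simp add: c_def)
  qed
  then obtain a\<^sub>1 where a\<^sub>1: "\<And>x. a\<^sub>1 \<le> x \<Longrightarrow> c \<le> (1 - \<theta>) * ln x + q"
    by (auto simp: eventually_at_top_linorder)
  \<comment> \<open>From \<open>exp 1\<close> on, \<open>ln x \<ge> 1\<close>, so that \<open>(ln x) powr p\<close> is increasing in \<open>p\<close>.\<close>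
  define a where "a = Max {a\<^sub>1, x\<^sub>0, exp 1}"
  have a: "a\<^sub>1 \<le> a" "x\<^sub>0 \<le> a" "exp 1 \<le> a"
    by (auto simp: a_def)
  define G where "G x = x powr (1 - \<theta>) * ln x powr q" for x
  define g where "g x = x powr (- \<theta>) * ln x powr (q - 1) * ((1 - \<theta>) * ln x + q)" for x
  have ln_ge: "1 \<le> ln x" "0 < x" "1 \<le> x" if "a \<le> x" for x
    using that a(3) one_le_exp_iff[of "1::real"] ln_ge_iff[of x 1] by linarith+
  have deriv: "(G has_real_derivative g x) (at x)" if "a \<le> x" for x
  proof -
    have "0 < x" "0 < ln x"
      using ln_ge[OF that] by linarith+
    then have "(G has_real_derivative
        (1 - \<theta>) * x powr (1 - \<theta> - of_nat 1) * 1 * ln x powr q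
        + q * ln x powr (q - of_nat 1) * (1 / x) * x powr (1 - \<theta>)) (at x)"
      unfolding G_def by (intro DERIV_mult DERIV_fun_powr DERIV_ident DERIV_ln_divide)
    also have "(1 - \<theta>) * x powr (1 - \<theta> - of_nat 1) * 1 * ln x powr q
        + q * ln x powr (q - of_nat 1) * (1 / x) * x powr (1 - \<theta>) = g x"
    proof -
      have "ln x powr q = ln x powr (q - 1) * ln x"
        using \<open>0 < ln x\<close> by (simp add: powr_diff del: ln_gt_zero_iff)
      moreover have "x powr (1 - \<theta>) = x * x powr (- \<theta>)"
        using \<open>0 < x\<close> by (simp add: powr_diff powr_minus field_simps)
      ultimately show ?thesis
        using \<open>0 < x\<close> by (simp add: g_def algebra_simps)
    qed
    finally show ?thesis .
  qed
  have g_pos: "0 \<le> g x" if "a \<le> x" for x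
    using a\<^sub>1[of x] that a c by (auto simp: g_def)
  have G_mono: "G a \<le> G b" if "a \<le> b" for b
    by (rule DERIV_nonneg_imp_nondecreasing[OF that]) (metis deriv g_pos)
  have G_pos: "0 < G a"
  proof -
    have "a \<noteq> 0" "ln a \<noteq> 0"
      using ln_ge[of a] by linarith+
    then show ?thesis
      unfolding G_def by (intro mult_pos_pos powr_gt_zero[THEN iffD2])
  qed
  define D where "D = \<bar>C\<bar> / c"
  have D: "0 \<le> D"
    using c by (simp add: D_def)
  have tail: "C * x powr (- \<theta>) * ln x powr \<phi> \<le> D * g x" if x: "a \<le> x" for x
  proof -
    have "C * x powr (- \<theta>) * ln x powr \<phi> \<le> \<bar>C\<bar> * (x powr (- \<theta>) * ln x powr (q - 1))"
      unfolding mult.assoc using ln_ge[OF x] q(1)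
      by (intro mult_mono powr_mono) auto
    also have "\<dots> = D * (x powr (- \<theta>) * ln x powr (q - 1) * c)"
      using c by (simp add: D_def)
    also have "\<dots> \<le> D * g x"
      unfolding g_def using D a\<^sub>1[of x] x a by (intro mult_left_mono) auto
    finally show ?thesis .
  qed
  show ?thesis
  proof (rule exI[of _ "a / G a + D"], rule exI[of _ a], intro conjI allI impI)
    show "0 \<le> a / G a + D"
      using D G_pos ln_ge[of a] by simp
    fix i b
    assume b: "a \<le> b"
    have "(\<integral>\<^sup>+\<omega>. ennreal (min (Y i \<omega>) b) \<partial>M) \<le> ennreal (a + (D * G b - D * G a))"
    proof (rule nn_integral_min_le_tail_antiderivative[where g = "\<lambda>x. D * g x" and G = "\<lambda>x. D * G x"])
      show "prob {\<omega> \<in> space M. x \<le> Y i \<omega>} \<le> D * g x" if "a \<le> x" for x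
        using uniform_tail[of x i] tail[OF that] that a(2) by linarith
      show "((\<lambda>x. D * G x) has_real_derivative D * g x) (at x)" if "a \<le> x" for x
        using deriv[OF that] by (rule DERIV_cmult)
      show "(\<lambda>x. D * g x) \<in> borel_measurable borel"
        unfolding g_def by measurable
      show "0 \<le> a"
        using ln_ge[of a] by simp
    qed (use Y nonneg b in simp_all)
    \<comment> \<open>Since \<open>G\<close> is positive and nondecreasing, the additive constant \<open>a\<close> is at most
      \<open>(a / G a) * G b\<close>.\<close>
    also have "\<dots> \<le> ennreal ((a / G a + D) * G b)"
    proof (rule ennreal_leI)
      have "a = a / G a * G a"
        using G_pos by simp
      also have "\<dots> \<le> a / G a * G b"
        using G_mono[OF b] G_pos ln_ge[of a] by (intro mult_left_mono) auto
      finally show "a + (D * G b - D * G a) \<le> (a / G a + D) * G b"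
        using mult_nonneg_nonneg[OF D less_imp_le[OF G_pos]] unfolding distrib_right by linarith
    qed
    finally show "(\<integral>\<^sup>+\<omega>. ennreal (min (Y i \<omega>) b) \<partial>M)
        \<le> ennreal ((a / G a + D) * (b powr (1 - \<theta>) * ln b powr q))"
      by (simp add: G_def)
  qed
qed

text \<open>
  The threshold for \<open>r\<close> comes from \<open>G(b n) / b n = (b n) powr (- \<theta>) * (ln (b n)) powr q\<close>, which is
  of order \<open>1 / (n * (ln n) powr (\<theta> * r - q))\<close>: the sum over \<open>n\<close> is finite when the exponent
  exceeds 1.
\<close>

lemma (in prob_space) AE_eventually_sum_le_power_log:
  fixes Y :: "nat \<Rightarrow> 'a \<Rightarrow> real" and C \<theta> \<phi> q r x\<^sub>0 :: real
  assumes Y: "\<And>n. Y n \<in> borel_measurable M"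
    and nonneg: "\<And>n \<omega>. \<omega> \<in> space M \<Longrightarrow> 0 \<le> Y n \<omega>"
    and \<theta>: "0 < \<theta>" "\<theta> \<le> 1"
    and tail: "\<And>n x. x\<^sub>0 \<le> x \<Longrightarrow>
        prob {\<omega> \<in> space M. x \<le> Y n \<omega>} \<le> C * x powr (- \<theta>) * ln x powr \<phi>"
    and q: "\<phi> + 1 \<le> q" "\<theta> < 1 \<or> 0 < q"
    and r: "q + 1 < \<theta> * r"
  shows "AE \<omega> in M. eventually (\<lambda>n. (\<Sum>k<n. Y k \<omega>) \<le> real n powr (1 / \<theta>) * ln (real n) powr r)
           sequentially"
proof -
  define b where "b n = real n powr (1 / \<theta>) * ln (real n) powr r" for n :: nat
  have "\<exists>K a. 0 \<le> K \<and> (\<forall>n. \<forall>b\<ge>a.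
      (\<integral>\<^sup>+\<omega>. ennreal (min (Y n \<omega>) b) \<partial>M) \<le> ennreal (K * (b powr (1 - \<theta>) * ln b powr q)))"
    by (rule nn_integral_min_le_power_log[OF Y nonneg \<theta> tail q])
  then obtain K a where K: "0 \<le> K" and min_le: "\<forall>n. \<forall>b\<ge>a.
      (\<integral>\<^sup>+\<omega>. ennreal (min (Y n \<omega>) b) \<partial>M) \<le> ennreal (K * (b powr (1 - \<theta>) * ln b powr q))"
    by (elim exE conjE)
  have "(\<lambda>n. b n powr (- \<theta>) * ln (b n) powr q) \<in> O(\<lambda>n. 1 / (real n * ln (real n) powr (\<theta> * r - q)))"
    unfolding b_def using \<theta>(1) by real_asymp
  then obtain L where L: "0 < L"
    and le: "eventually (\<lambda>n. norm (b n powr (- \<theta>) * ln (b n) powr q)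
               \<le> L * norm (1 / (real n * ln (real n) powr (\<theta> * r - q)))) sequentially"
    by (rule landau_o.bigE)
  have lim: "filterlim b at_top sequentially"
    unfolding b_def using \<theta>(1) by real_asymp
  have "AE \<omega> in M. eventually (\<lambda>n. (\<Sum>k<n. Y k \<omega>) \<le> b n) sequentially"
  proof (rule AE_eventually_sum_le[where e = "\<lambda>n. K * L * (1 / (real n * ln (real n) powr (\<theta> * r - q)))"])
    show "eventually (\<lambda>n. b n \<le> b (Suc n)) sequentially"
      unfolding b_def using \<theta>(1) by real_asymp
    show "summable (\<lambda>n. K * L * (1 / (real n * ln (real n) powr (\<theta> * r - q))))"
      using r by (intro summable_mult summable_inverse_mult_ln_powr) simp
    have "eventually (\<lambda>n. max a 1 \<le> b n) sequentially"
      using lim unfolding filterlim_at_top by blast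
    with le show "eventually (\<lambda>n. (\<integral>\<^sup>+\<omega>. ennreal (min (Y n \<omega>) (b n)) \<partial>M)
        \<le> ennreal (b n * (K * L * (1 / (real n * ln (real n) powr (\<theta> * r - q)))))) sequentially"
    proof eventually_elim
      case (elim n)
      have "(\<integral>\<^sup>+\<omega>. ennreal (min (Y n \<omega>) (b n)) \<partial>M)
          \<le> ennreal (K * (b n powr (1 - \<theta>) * ln (b n) powr q))"
        using elim(2) by (intro min_le[rule_format]) simp
      also have "K * (b n powr (1 - \<theta>) * ln (b n) powr q)
          = b n * K * (b n powr (- \<theta>) * ln (b n) powr q)"
        using elim by (simp add: powr_diff powr_minus field_simps)
      also have "ennreal \<dots> \<le> ennreal (b n * K * (L * (1 / (real n * ln (real n) powr (\<theta> * r - q)))))"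
        using elim K by (intro ennreal_leI mult_left_mono) auto
      finally show ?case
        by (simp add: mult_ac)
    qed
  qed (use Y nonneg lim K L in auto)
  then show ?thesis
    by (simp add: b_def)
qed

section \<open>Conditional tails and the growth of the process\<close>

lemma (in prob_space) prob_le_of_cond_prob_alg_le:
  assumes F: "subalgebra M F"
    and P [measurable]: "Measurable.pred M P"
    and bound: "AE \<omega> in M. cond_prob_alg M F P \<omega> \<le> c"
  shows "prob {\<omega> \<in> space M. P \<omega>} \<le> c"
proof -
  interpret finite_measure_subalgebra M F
    by unfold_locales (rule F)
  let ?I = "indicator {\<omega> \<in> space M. P \<omega>} :: 'a \<Rightarrow> real"
  have int: "integrable M ?I"
    by (simp add: integrable_indicator_iff emeasure_eq_measure)
  have "prob {\<omega> \<in> space M. P \<omega>} = (\<integral>\<omega>. ?I \<omega> \<partial>M)"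
    by simp
  also have "\<dots> = (\<integral>\<omega>. cond_prob_alg M F P \<omega> \<partial>M)"
    unfolding cond_prob_alg_def using int by (simp add: real_cond_exp_int)
  also have "\<dots> \<le> (\<integral>\<omega>. c \<partial>M)"
    using bound int unfolding cond_prob_alg_def
    by (intro integral_mono_AE) (auto simp: real_cond_exp_int)
  also have "\<dots> = c"
    by (simp add: prob_space)
  finally show ?thesis .
qed

theorem theorem2p2:
  fixes M :: "'a measure"
    and F :: "nat \<Rightarrow> 'a measure"
    and X :: "nat \<Rightarrow> 'a \<Rightarrow> real"
    and \<theta> \<phi> x\<^sub>0 C :: real
  assumes "prob_space M"
    and "filtration (space M) F"
    and "\<And>t. subalgebra M (F t)"
    and "\<And>t. X t \<in> borel_measurable (F t)"
    and "\<And>\<omega>. \<omega> \<in> space M \<Longrightarrow> X 0 \<omega> = 0"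
    and "0 < \<theta>" and "\<theta> \<le> 1"
    and "1 < x\<^sub>0"
    and "\<And>x t. x\<^sub>0 \<le> x \<Longrightarrow>
           AE \<omega> in M. cond_prob_alg M (F t) (\<lambda>\<omega>'. pos_part (increment X t \<omega>') \<ge> x) \<omega>
                        \<le> C * x powr (- \<theta>) * (ln x) powr \<phi>"
  shows "(\<theta> < 1 \<longrightarrow>
            (\<forall>\<epsilon>>0. AE \<omega> in M. \<forall>\<^sub>\<infinity>t.
               X t \<omega> \<le> real t powr (1 / \<theta>) * (ln (real t)) powr ((\<phi> + 2) / \<theta> + \<epsilon>)))
       \<and> (\<theta> = 1 \<longrightarrow>
            (\<forall>\<epsilon>>0. AE \<omega> in M. \<forall>\<^sub>\<infinity>t.
               X t \<omega> \<le> real t * (ln (real t)) powr (pos_part (1 + \<phi>) + 1 + \<epsilon>)))"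
proof -
  interpret prob_space M by fact
  have X [measurable]: "X t \<in> borel_measurable M" for t
    using assms(3,4) by (rule measurable_from_subalg)
  define Y where "Y t \<omega> = pos_part (increment X t \<omega>)" for t \<omega>
  have Y [measurable]: "Y t \<in> borel_measurable M" for t
    unfolding Y_def pos_part_def increment_def by measurable
  have tail: "prob {\<omega> \<in> space M. x \<le> Y t \<omega>} \<le> C * x powr (- \<theta>) * ln x powr \<phi>" if "x\<^sub>0 \<le> x" for x t
    using assms(9)[OF that, of t] assms(3)
    unfolding Y_def[symmetric] by (intro prob_le_of_cond_prob_alg_le) auto
  have X_le: "X t \<omega> \<le> (\<Sum>s<t. Y s \<omega>)" if "\<omega> \<in> space M" for t \<omega>
  proof -
    have "X t \<omega> = (\<Sum>s<t. increment X s \<omega>)"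
      using assms(5)[OF that] sum_lessThan_telescope[of "\<lambda>s. X s \<omega>" t]
      by (simp add: increment_def)
    also have "\<dots> \<le> (\<Sum>s<t. Y s \<omega>)"
      by (intro sum_mono) (simp add: Y_def pos_part_def)
    finally show ?thesis .
  qed
  have growth: "AE \<omega> in M. \<forall>\<^sub>\<infinity>t. X t \<omega> \<le> real t powr (1 / \<theta>) * ln (real t) powr r"
    if "\<phi> + 1 \<le> q" "\<theta> < 1 \<or> 0 < q" "q + 1 < \<theta> * r" for q r
  proof -
    have "AE \<omega> in M. eventually (\<lambda>n. (\<Sum>k<n. Y k \<omega>) \<le> real n powr (1 / \<theta>) * ln (real n) powr r)
            sequentially"
      by (rule AE_eventually_sum_le_power_log[OF Y _ assms(6,7) tail that])
         (auto simp: Y_def pos_part_def)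
    then show ?thesis
      using AE_space
    proof eventually_elim
      case (elim \<omega>)
      from elim(1) show ?case
        unfolding cofinite_eq_sequentially
        by eventually_elim (use X_le[OF elim(2)] order_trans in blast)
    qed
  qed
  show ?thesis
  proof (intro conjI impI allI)
    fix \<epsilon> :: real
    assume \<theta>: "\<theta> < 1" and \<epsilon>: "0 < \<epsilon>"
    show "AE \<omega> in M. \<forall>\<^sub>\<infinity>t. X t \<omega> \<le> real t powr (1 / \<theta>) * ln (real t) powr ((\<phi> + 2) / \<theta> + \<epsilon>)"
    proof (rule growth[of "\<phi> + 1"])
      show "\<phi> + 1 + 1 < \<theta> * ((\<phi> + 2) / \<theta> + \<epsilon>)"
        using assms(6) \<epsilon> by (simp add: distrib_left[of \<theta> "(\<phi> + 2) / \<theta>"])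
    qed (use \<theta> in auto)
  next
    fix \<epsilon> :: real
    assume \<theta>: "\<theta> = 1" and \<epsilon>: "0 < \<epsilon>"
    \<comment> \<open>One half of \<open>\<epsilon>\<close> keeps \<open>q\<close> positive when \<open>\<phi> \<le> - 1\<close>; the other half makes the series
      converge.\<close>
    define q where "q = max (\<phi> + 1) (\<epsilon> / 2)"
    have q: "q \<le> pos_part (1 + \<phi>) + \<epsilon> / 2"
      using \<epsilon> by (auto simp: q_def pos_part_def)
    have "AE \<omega> in M. \<forall>\<^sub>\<infinity>t. X t \<omega> \<le> real t powr (1 / \<theta>) * ln (real t) powr (pos_part (1 + \<phi>) + 1 + \<epsilon>)"
      by (rule growth[of q]) (use \<theta> \<epsilon> q in \<open>auto simp: q_def\<close>)
    then show "AE \<omega> in M. \<forall>\<^sub>\<infinity>t. X t \<omega> \<le> real t * ln (real t) powr (pos_part (1 + \<phi>) + 1 + \<epsilon>)"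
      using \<theta> by simp
  qed
qed

end
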